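(* Let $q$ be a prime power, let $n=m$, let $d\le n$ be even, and let $\tau=d/2$. Then there exist a code $\mathcal C\subseteq\mathbb F_{q^m}^n$ with minimum rank distance exactly $d$ and a word $\mathbf r\in\mathbb F_{q^m}^n$ such that $|\mathcal C\cap\mathcal B_\tau(\mathbf r)|\ge q^{n-\tau}$.
   Context: Fixing a basis of $\mathbb F_{q^m}$ over $\mathbb F_q$, each vector in $\mathbb F_{q^m}^n$ is identified with an $m\times n$ matrix over $\mathbb F_q$; $\mathrm{rk}$ denotes its rank. The minimum rank distance of $\mathcal C$ is $\min\{\mathrm{rk}(\mathbf c_1-\mathbf c_2):\mathbf c_1\ne\mathbf c_2\in\mathcal C\}$, and $\mathcal B_\tau(\mathbf r)=\{\mathbf x:\mathrm{rk}(\mathbf x-\mathbf r)\le\tau\}$. Codes need not be linear. *)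

theory Defs
  imports "HOL-Analysis.Analysis"
begin

text \<open>Words of F_{q^m}^n are identified (via a fixed basis) with m x n matrices over F_q,
  here of type 'a^'n^'m with 'a a finite field of order q. The rank distance is the rank of
  the difference.\<close>

definition rank_dist :: "'a::field^'n^'m \<Rightarrow> 'a^'n^'m \<Rightarrow> nat" where
  "rank_dist x y = rank (x - y)"

definition min_rank_distance :: "('a::field^'n^'m) set \<Rightarrow> nat" where
  "min_rank_distance C = Min {rank_dist c1 c2 | c1 c2. c1 \<in> C \<and> c2 \<in> C \<and> c1 \<noteq> c2}"

definition rank_ball :: "nat \<Rightarrow> 'a::field^'n^'m \<Rightarrow> ('a^'n^'m) set" where
  "rank_ball \<tau> r = {x. rank (x - r) \<le> \<tau>}"

end

theory Submission
  imports Defs "HOL-Algebra.Algebraic_Closure_Type"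
begin

text \<open>Write \<open>n = t + k\<close> with \<open>d = 2 t\<close>. In the algebraic closure of \<open>F_q\<close>, the roots of
  \<open>z ^ q ^ k = z\<close> form the field \<open>F_{q^k}\<close>, a \<open>k\<close>-dimensional \<open>F_q\<close>-space; fix a
  \<open>t\<close>-dimensional subspace \<open>U\<close> of it and a linear projection \<open>\<pi>\<close> onto \<open>U\<close>. On the
  \<open>n\<close>-dimensional space \<open>V = U \<times> F_{q^k}\<close>, every \<open>s \<in> F_{q^k}\<close> gives the linear map
  \<open>(x, y) \<mapsto> (w, s w)\<close> with \<open>w = x + \<pi> (s y)\<close>. Its image lies in the graph of multiplication
  by \<open>s\<close> on \<open>U\<close>, so its rank is at most \<open>t\<close>; for \<open>s \<noteq> u\<close> the difference of the two maps has
  image \<open>{(a - b, s a - u b) | a, b \<in> U}\<close>, of dimension \<open>2 t\<close> because \<open>s - u\<close> is invertible.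
  In a basis of \<open>V\<close> these \<open>q ^ k\<close> maps are matrices in the rank ball of radius \<open>t\<close> around
  \<open>0\<close>, at pairwise rank distance exactly \<open>d\<close>.\<close>

section \<open>Finite fields\<close>

lemma card_field_ge_2: "CARD('a::{finite,field}) \<ge> 2"
proof -
  have "card {0::'a, 1} \<le> CARD('a)" by (rule card_mono) auto
  thus ?thesis by simp
qed

lemma field_power_card_eq_self:
  fixes x :: "'a::{finite,field}"
  shows "x ^ CARD('a) = x"
proof (cases "x = 0")
  case True
  thus ?thesis by simp
next
  case False
  define U where "U = UNIV - {0::'a}"
  have "bij_betw ((*) x) U U"
    unfolding U_def by (rule bij_betwI[of _ _ _ "(*) (inverse x)"]) (use False in \<open>auto simp: field_simps\<close>)
  hence "x ^ card U * \<Prod>U = 1 * \<Prod>U"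
    using prod.reindex_bij_betw[of "(*) x" U U id] by (simp add: prod.distrib)
  moreover have "\<Prod>U \<noteq> 0" unfolding U_def by simp
  ultimately have "x ^ card U = 1" by (rule mult_right_cancel[THEN iffD1, rotated])
  moreover have "CARD('a) = Suc (card U)"
    unfolding U_def by (subst card_Diff_singleton) auto
  ultimately show ?thesis by simp
qed

lemma field_power_card_power_eq_self:
  fixes x :: "'a::{finite,field}"
  shows "x ^ (CARD('a) ^ k) = x"
  by (induction k) (simp_all add: power_mult field_power_card_eq_self)

text \<open>The polynomial \<open>(X + 1) ^ q - X ^ q - 1\<close>, whose coefficients are the inner binomial
  coefficients, has degree below \<open>q\<close> but vanishes on all \<open>q\<close> field elements.\<close>
lemma of_nat_card_choose_eq_0:
  assumes "0 < i" "i < CARD('a::{finite,field})"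
  shows "of_nat (CARD('a) choose i) = (0::'a)"
proof -
  let ?q = "CARD('a)"
  define p :: "'a poly" where "p = [:1, 1:] ^ ?q - Polynomial.monom 1 ?q - 1"
  have coeff_p: "Polynomial.coeff p j = (if 0 < j \<and> j < ?q then of_nat (?q choose j) else 0)" for j
  proof (cases "j \<le> ?q")
    case True
    thus ?thesis by (auto simp: p_def coeff_linear_poly_power Polynomial.coeff_monom coeff_1)
  next
    case False
    have "Polynomial.degree ([:1, 1::'a:] ^ ?q) < j" using False by (simp add: degree_linear_power)
    thus ?thesis using False by (simp add: p_def coeff_eq_0 Polynomial.coeff_monom coeff_1)
  qed
  have "p = 0"
  proof (rule ccontr)
    assume "p \<noteq> 0"
    have "poly p x = 0" for x
      by (simp add: p_def Polynomial.poly_monom field_power_card_eq_self)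
    hence "?q \<le> Polynomial.degree p"
      using card_poly_roots_bound[OF \<open>p \<noteq> 0\<close>] by simp
    moreover have "Polynomial.degree p \<le> ?q - 1"
      by (rule Polynomial.degree_le) (auto simp: coeff_p)
    ultimately show False
      using card_field_ge_2[where 'a='a] by linarith
  qed
  thus ?thesis using coeff_p[of i] assms by simp
qed

lemma of_nat_card_eq_0: "of_nat CARD('a::{finite,field}) = (0::'a)"
  using of_nat_card_choose_eq_0[of 1, where 'a='a] card_field_ge_2[where 'a='a] by simp

lemma power_add_eq_if_binomials_vanish:
  fixes x y :: "'b::comm_semiring_1"
  assumes "0 < n" and "\<And>i. 0 < i \<Longrightarrow> i < n \<Longrightarrow> of_nat (n choose i) = (0::'b)"
  shows "(x + y) ^ n = x ^ n + y ^ n"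
proof -
  have "(x + y) ^ n = (\<Sum>i\<le>n. of_nat (n choose i) * x ^ i * y ^ (n - i))"
    by (rule binomial_ring)
  also have "\<dots> = (\<Sum>i\<in>{0, n}. of_nat (n choose i) * x ^ i * y ^ (n - i))"
    by (rule sum.mono_neutral_right) (use assms in auto)
  finally show ?thesis
    using assms(1) by (simp add: add.commute)
qed

lemma alg_closure_power_card_add:
  fixes y z :: "'a::{finite,field} alg_closure"
  shows "(y + z) ^ CARD('a) = y ^ CARD('a) + z ^ CARD('a)"
proof (rule power_add_eq_if_binomials_vanish)
  fix i assume "0 < i" "i < CARD('a)"
  hence "to_ac (of_nat (CARD('a) choose i) :: 'a) = 0"
    by (simp only: of_nat_card_choose_eq_0 to_ac_0)
  thus "of_nat (CARD('a) choose i) = (0 :: 'a alg_closure)" by simp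
qed simp

lemma alg_closure_power_card_power_add:
  fixes y z :: "'a::{finite,field} alg_closure"
  shows "(y + z) ^ (CARD('a) ^ k) = y ^ (CARD('a) ^ k) + z ^ (CARD('a) ^ k)"
proof (induction k)
  case (Suc k)
  have "(y + z) ^ (CARD('a) ^ Suc k) = ((y + z) ^ (CARD('a) ^ k)) ^ CARD('a)"
    by (simp only: power_Suc2 power_mult)
  also have "\<dots> = (y ^ (CARD('a) ^ k)) ^ CARD('a) + (z ^ (CARD('a) ^ k)) ^ CARD('a)"
    by (simp only: Suc.IH alg_closure_power_card_add)
  finally show ?case by (simp only: power_Suc2 power_mult)
qed simp

lemma pderiv_eval_eq_0_if_double_root:
  fixes p :: "'a::idom poly"
  assumes "[:-a, 1:] ^ 2 dvd p"
  shows "poly (pderiv p) a = 0"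
proof -
  obtain h where "p = [:-a, 1:] ^ 2 * h" using assms by (rule dvdE)
  hence "p = [:-a, 1:] * ([:-a, 1:] * h)" by (simp only: power2_eq_square mult.assoc)
  moreover have root: "poly [:-a, 1:] a = 0" by simp
  ultimately show ?thesis by (simp only: pderiv_mult poly_add poly_mult root) simp
qed

lemma card_roots_eq_degree_if_separable:
  fixes p :: "'a::alg_closed_field poly"
  assumes "p \<noteq> 0" and separable: "\<And>x. poly p x = 0 \<Longrightarrow> poly (pderiv p) x \<noteq> 0"
  shows "card {x. poly p x = 0} = Polynomial.degree p"
proof -
  obtain A where A: "size A = Polynomial.degree p"
    and p_eq: "p = Polynomial.smult (Polynomial.lead_coeff p) (\<Prod>x\<in>#A. [:-x, 1:])"
    using alg_closed_imp_factorization[OF \<open>p \<noteq> 0\<close>] by blast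
  have roots: "{x. poly p x = 0} = set_mset A"
  proof -
    have "Polynomial.lead_coeff p \<noteq> 0" using \<open>p \<noteq> 0\<close> by simp
    moreover have "poly p x = Polynomial.lead_coeff p * (\<Prod>y\<in>#A. x - y)" for x
      by (subst p_eq) (simp add: poly_prod_mset multiset.map_comp o_def)
    ultimately show ?thesis by (auto simp: prod_mset_zero_iff)
  qed
  have simple: "count A x \<le> 1" for x
  proof (rule ccontr)
    assume "\<not> count A x \<le> 1"
    hence double: "replicate_mset 2 x \<subseteq># A"
      by (simp add: count_le_replicate_mset_subset_eq[symmetric])
    hence "(\<Prod>y\<in>#replicate_mset 2 x. [:-y, 1:]) dvd (\<Prod>y\<in>#A. [:-y, 1:])"
      by (intro prod_mset_subset_imp_dvd image_mset_subseteq_mono)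
    hence "[:-x, 1:] ^ 2 dvd (\<Prod>y\<in>#A. [:-y, 1:])" by simp
    hence "[:-x, 1:] ^ 2 dvd p" by (subst p_eq) (rule dvd_smult)
    hence "poly (pderiv p) x = 0" by (rule pderiv_eval_eq_0_if_double_root)
    moreover have "poly p x = 0" using roots double by (auto dest: mset_subset_eqD)
    ultimately show False using separable by blast
  qed
  have "size A = (\<Sum>x\<in>set_mset A. count A x)"
    by (simp add: size_multiset_overloaded_eq)
  also have "\<dots> = (\<Sum>x\<in>set_mset A. 1)"
  proof (intro sum.cong refl)
    fix x assume "x \<in># A"
    hence "0 < count A x" by simp
    with simple[of x] show "count A x = 1" by linarith
  qed
  also have "\<dots> = card (set_mset A)" by simp
  finally show ?thesis using roots A by simp
qed

text \<open>The field \<open>F_{q^k}\<close>.\<close>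
definition frobenius_fixed_field :: "nat \<Rightarrow> 'a::{finite,field} alg_closure set" where
  "frobenius_fixed_field k = {z. z ^ (CARD('a) ^ k) = z}"

lemma card_frobenius_fixed_field:
  assumes "0 < k"
  shows "card (frobenius_fixed_field k :: 'a::{finite,field} alg_closure set) = CARD('a) ^ k"
proof -
  let ?Q = "CARD('a) ^ k"
  have "CARD('a) ^ 1 \<le> ?Q"
    using assms by (intro power_increasing) auto
  hence Q_ge_2: "2 \<le> ?Q" using card_field_ge_2[where 'a='a] by simp
  define p :: "'a alg_closure poly" where "p = Polynomial.monom 1 ?Q + [:0, -1:]"
  have degree_p: "Polynomial.degree p = ?Q"
    using Q_ge_2 by (simp add: p_def degree_add_eq_left Polynomial.degree_monom_eq)
  hence "p \<noteq> 0" using Q_ge_2 by auto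
  have "of_nat ?Q = (0 :: 'a alg_closure)"
    using assms by (simp flip: to_ac_of_nat add: of_nat_card_eq_0)
  hence "poly (pderiv p) z = -1" for z using assms
    by (simp add: p_def pderiv_add pderiv_monom pderiv_pCons power_0_left)
  hence "card {z. poly p z = 0} = ?Q"
    using card_roots_eq_degree_if_separable[OF \<open>p \<noteq> 0\<close>] degree_p by simp
  moreover have "{z. poly p z = 0} = frobenius_fixed_field k"
    by (simp add: p_def Polynomial.poly_monom frobenius_fixed_field_def)
  ultimately show ?thesis by simp
qed

lemma frobenius_fixed_field_add:
  "y \<in> frobenius_fixed_field k \<Longrightarrow> z \<in> frobenius_fixed_field k \<Longrightarrow> y + z \<in> frobenius_fixed_field k"
  by (simp add: frobenius_fixed_field_def alg_closure_power_card_power_add)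

lemma frobenius_fixed_field_uminus:
  assumes "z \<in> frobenius_fixed_field k"
  shows "- z \<in> frobenius_fixed_field k"
proof -
  let ?Q = "CARD('a) ^ k"
  have "z + (- z) ^ ?Q = (z + - z) ^ ?Q"
    using assms by (simp only: alg_closure_power_card_power_add frobenius_fixed_field_def mem_Collect_eq)
  hence "(- z) ^ ?Q = - z" by (simp add: add_eq_0_iff power_0_left)
  thus ?thesis by (simp add: frobenius_fixed_field_def)
qed

lemma frobenius_fixed_field_diff:
  "y \<in> frobenius_fixed_field k \<Longrightarrow> z \<in> frobenius_fixed_field k \<Longrightarrow> y - z \<in> frobenius_fixed_field k"
  using frobenius_fixed_field_add[of y k "- z"] frobenius_fixed_field_uminus[of z k] by simp

lemma frobenius_fixed_field_mult:
  "y \<in> frobenius_fixed_field k \<Longrightarrow> z \<in> frobenius_fixed_field k \<Longrightarrow> y * z \<in> frobenius_fixed_field k"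
  by (simp add: frobenius_fixed_field_def power_mult_distrib)

lemma frobenius_fixed_field_inverse:
  "z \<in> frobenius_fixed_field k \<Longrightarrow> inverse z \<in> frobenius_fixed_field k"
  by (simp add: frobenius_fixed_field_def power_inverse)

lemma to_ac_in_frobenius_fixed_field: "to_ac a \<in> frobenius_fixed_field k"
  by (simp add: frobenius_fixed_field_def field_power_card_power_eq_self flip: to_ac_power)

section \<open>Vector spaces over a finite field\<close>

locale finite_field_vector_space = vector_space scale
  for scale :: "'a::{finite,field} \<Rightarrow> 'b::ab_group_add \<Rightarrow> 'b"
begin

lemma card_span:
  assumes "finite B" and "independent B"
  shows "card (span B) = CARD('a) ^ card B"
  using assms
proof (induction B rule: finite_induct)
  case empty
  then show ?case by simp
next
  case (insert b B)
  have "independent B" and b_notin: "b \<notin> span B"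
    using insert.prems insert.hyps(2) by (auto simp: independent_insert)
  let ?f = "\<lambda>(c, w). scale c b + w"
  have image: "span (insert b B) = ?f ` (UNIV \<times> span B)"
  proof
    show "span (insert b B) \<subseteq> ?f ` (UNIV \<times> span B)"
    proof
      fix x assume "x \<in> span (insert b B)"
      then obtain c where "x - scale c b \<in> span B" by (auto simp: span_insert)
      thus "x \<in> ?f ` (UNIV \<times> span B)"
        by (intro image_eqI[of _ _ "(c, x - scale c b)"]) auto
    qed
    show "?f ` (UNIV \<times> span B) \<subseteq> span (insert b B)"
      by (auto intro: span_add span_scale span_base span_mono[THEN subsetD, of B])
  qed
  have "inj_on ?f (UNIV \<times> span B)"
  proof (rule inj_onI, clarify)
    fix c w c' w' assume w: "w \<in> span B" "w' \<in> span B" and eq: "scale c b + w = scale c' b + w'"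
    have "scale (c - c') b = w' - w" using eq by (simp add: scale_left_diff_distrib algebra_simps)
    hence "scale (c - c') b \<in> span B" using w by (simp add: span_diff)
    hence "c = c'" using b_notin span_scale[of "scale (c - c') b" B "inverse (c - c')"]
      by (cases "c = c'") auto
    thus "c = c' \<and> w = w'" using eq by simp
  qed
  hence "card (span (insert b B)) = CARD('a) * card (span B)"
    unfolding image by (simp add: card_image card_cartesian_product)
  thus ?case using insert.IH[OF \<open>independent B\<close>] insert.hyps by simp
qed

lemma card_subspace:
  assumes "finite W" and "subspace W"
  shows "card W = CARD('a) ^ dim W"
proof -
  obtain B where B: "B \<subseteq> W" "independent B" "W \<subseteq> span B" "card B = dim W"
    using basis_exists by blast
  have "span B = W" using span_subspace[OF B(1) B(3) \<open>subspace W\<close>] .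
  thus ?thesis using card_span[OF finite_subset[OF B(1) \<open>finite W\<close>] B(2)] B(4) by simp
qed

lemma dim_eq_if_card_eq:
  assumes "finite W" and "subspace W" and "card W = CARD('a) ^ n"
  shows "dim W = n"
  using card_subspace[OF assms(1,2)] assms(3) card_field_ge_2[where 'a='a]
  by (simp add: power_inject_exp)

lemma exists_projection_onto_subspace:
  assumes "finite S" and "subspace S" and "t \<le> dim S"
  obtains U \<pi> where "U \<subseteq> S" "subspace U" "card U = CARD('a) ^ t"
    "Vector_Spaces.linear scale scale \<pi>" "\<pi> ` S \<subseteq> U" "\<And>u. u \<in> U \<Longrightarrow> \<pi> u = u"
proof -
  interpret pair: vector_space_pair scale scale ..
  obtain B where B: "B \<subseteq> S" "independent B" "S \<subseteq> span B" "card B = dim S"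
    using basis_exists by blast
  have span_B: "span B = S" using span_subspace[OF B(1) B(3) \<open>subspace S\<close>] .
  obtain B' where B': "B' \<subseteq> B" "card B' = t" "finite B'"
    using obtain_subset_with_card_n[of t B] B(4) assms(3) by auto
  define U where "U = span B'"
  define \<pi> where "\<pi> = pair.construct B (\<lambda>b. if b \<in> B' then b else 0)"
  have linear: "Vector_Spaces.linear scale scale \<pi>"
    unfolding \<pi>_def by (rule pair.linear_construct[OF B(2)])
  have \<pi>_B: "\<pi> b = (if b \<in> B' then b else 0)" if "b \<in> B" for b
    unfolding \<pi>_def using pair.construct_basis[OF B(2) that] .
  show ?thesis
  proof
    show "U \<subseteq> S" unfolding U_def using span_mono[OF B'(1)] span_B by simp
    show "subspace U" unfolding U_def by simp
    show "card U = CARD('a) ^ t"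
      unfolding U_def using card_span[OF B'(3) independent_mono[OF B(2) B'(1)]] B'(2) by simp
    show "Vector_Spaces.linear scale scale \<pi>" by (rule linear)
    have "\<pi> ` span B = span (\<pi> ` B)" by (rule pair.linear_span_image[OF linear, symmetric])
    also have "\<dots> \<subseteq> U"
      unfolding U_def using \<pi>_B by (intro span_minimal) (auto intro: span_base span_zero)
    finally show "\<pi> ` S \<subseteq> U" using span_B by simp
    show "\<pi> u = u" if "u \<in> U" for u
      using pair.linear_eq_on[OF linear linear_ident, of u B'] that \<pi>_B B'(1)
      unfolding U_def by (metis subsetD)
  qed
qed

lemma exists_linear_iso:
  assumes "finite V" and "subspace V" and "card V = CARD('a) ^ CARD('n)"
  obtains \<Phi> :: "'a^'n \<Rightarrow> 'b"
  where "Vector_Spaces.linear (*s) scale \<Phi>" "\<Phi> ` UNIV = V" "inj \<Phi>"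
proof -
  interpret pair: vector_space_pair "(*s) :: 'a \<Rightarrow> 'a^'n \<Rightarrow> _" scale ..
  obtain B where B: "B \<subseteq> V" "independent B" "V \<subseteq> span B" "card B = dim V"
    using basis_exists by blast
  have "dim V = CARD('n)" by (rule dim_eq_if_card_eq[OF assms])
  hence "\<exists>\<Phi> :: 'a^'n \<Rightarrow> 'b. Vector_Spaces.linear (*s) scale \<Phi> \<and> \<Phi> ` cart_basis = B \<and>
      \<Phi> ` UNIV = V \<and> inj_on \<Phi> UNIV"
    using pair.finite_basis_to_basis_subspace_isomorphism[OF vec.subspace_UNIV \<open>subspace V\<close> _
        finite_cart_basis subset_UNIV independent_cart_basis _ _ finite_subset[OF B(1) \<open>finite V\<close>] B]
    by (simp add: vec.dim_UNIV card_cart_basis)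
  thus ?thesis using that by blast
qed

end

text \<open>Row \<open>i\<close> holds the coordinates of \<open>h\<close> applied to the basis vector \<open>\<Phi> (axis i 1)\<close>,
  so that the rank of the matrix is the dimension of the image of \<open>h\<close>.\<close>
definition matrix_wrt :: "('a::field^'n \<Rightarrow> 'b) \<Rightarrow> ('b \<Rightarrow> 'b) \<Rightarrow> 'a^'n^'n" where
  "matrix_wrt \<Phi> h = (\<chi> i. inv_into UNIV \<Phi> (h (\<Phi> (axis i 1))))"

lemma rank_zero: "rank (0 :: 'a::field^'n^'m) = 0"
proof -
  have "rows (0 :: 'a^'n^'m) = {0}" by (auto simp: rows_def row_def vec_eq_iff)
  thus ?thesis by (simp add: row_rank_def_gen)
qed

context finite_field_vector_space
begin

context
  fixes \<Phi> :: "'a^'n \<Rightarrow> 'b" and V :: "'b set"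
  assumes linear_\<Phi>: "Vector_Spaces.linear (*s) scale \<Phi>" and range_\<Phi>: "\<Phi> ` UNIV = V" and inj_\<Phi>: "inj \<Phi>"
begin

lemma row_matrix_wrt:
  assumes "h ` V \<subseteq> V"
  shows "\<Phi> (row i (matrix_wrt \<Phi> h)) = h (\<Phi> (axis i 1))"
proof -
  have "h (\<Phi> (axis i 1)) \<in> range \<Phi>" using assms range_\<Phi> by blast
  thus ?thesis by (simp add: matrix_wrt_def row_def f_inv_into_f)
qed

lemma diff_mem_range:
  assumes "x \<in> V" and "y \<in> V"
  shows "x - y \<in> V"
proof -
  interpret pair: vector_space_pair "(*s) :: 'a \<Rightarrow> 'a^'n \<Rightarrow> _" scale ..
  obtain a b where "x = \<Phi> a" "y = \<Phi> b" using assms range_\<Phi> by blast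
  hence "x - y = \<Phi> (a - b)" by (simp add: pair.linear_diff[OF linear_\<Phi>])
  thus ?thesis using range_\<Phi> by blast
qed

lemma matrix_wrt_diff:
  assumes "h ` V \<subseteq> V" and "g ` V \<subseteq> V"
  shows "matrix_wrt \<Phi> (\<lambda>v. h v - g v) = matrix_wrt \<Phi> h - matrix_wrt \<Phi> g"
proof -
  interpret pair: vector_space_pair "(*s) :: 'a \<Rightarrow> 'a^'n \<Rightarrow> _" scale ..
  have hg: "(\<lambda>v. h v - g v) ` V \<subseteq> V"
    using assms by (auto intro: diff_mem_range)
  have "\<Phi> (row i (matrix_wrt \<Phi> (\<lambda>v. h v - g v))) = \<Phi> (row i (matrix_wrt \<Phi> h - matrix_wrt \<Phi> g))" for i
  proof -
    have "row i (matrix_wrt \<Phi> h - matrix_wrt \<Phi> g) = row i (matrix_wrt \<Phi> h) - row i (matrix_wrt \<Phi> g)"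
      by (simp add: row_def vec_eq_iff)
    thus ?thesis
      by (simp only: pair.linear_diff[OF linear_\<Phi>] row_matrix_wrt[OF assms(1)]
          row_matrix_wrt[OF assms(2)] row_matrix_wrt[OF hg])
  qed
  hence "row i (matrix_wrt \<Phi> (\<lambda>v. h v - g v)) = row i (matrix_wrt \<Phi> h - matrix_wrt \<Phi> g)" for i
    using inj_\<Phi> by (simp add: inj_eq)
  thus ?thesis by (simp add: row_def vec_eq_iff)
qed

lemma power_rank_matrix_wrt:
  assumes "Vector_Spaces.linear scale scale h" and "h ` V \<subseteq> V"
  shows "CARD('a) ^ rank (matrix_wrt \<Phi> h) = card (h ` V)"
proof -
  interpret pair: vector_space_pair "(*s) :: 'a \<Rightarrow> 'a^'n \<Rightarrow> _" scale ..
  interpret endo: vector_space_pair scale scale ..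
  let ?M = "matrix_wrt \<Phi> h"
  have "\<Phi> ` rows ?M = (\<lambda>i. \<Phi> (row i ?M)) ` UNIV"
    unfolding rows_def by auto
  also have "\<dots> = h ` \<Phi> ` cart_basis"
    unfolding row_matrix_wrt[OF assms(2)] cart_basis_def by auto
  finally have rows: "\<Phi> ` rows ?M = h ` \<Phi> ` cart_basis" .
  have "\<Phi> ` vec.span (rows ?M) = span (\<Phi> ` rows ?M)"
    by (rule pair.linear_span_image[OF linear_\<Phi>, symmetric])
  also have "\<dots> = h ` span (\<Phi> ` cart_basis)"
    unfolding rows by (rule endo.linear_span_image[OF assms(1)])
  also have "span (\<Phi> ` cart_basis) = V"
    using range_\<Phi> by (simp add: pair.linear_span_image[OF linear_\<Phi>])
  finally have "card (vec.span (rows ?M)) = card (h ` V)"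
    by (metis card_image inj_on_subset[OF inj_\<Phi> subset_UNIV])
  moreover have "card (vec.span (rows ?M)) = CARD('a) ^ rank ?M"
  proof -
    interpret coord: finite_field_vector_space "(*s) :: 'a \<Rightarrow> 'a^'n \<Rightarrow> _" ..
    show ?thesis by (simp add: coord.card_subspace row_rank_def_gen)
  qed
  ultimately show ?thesis by simp
qed

end

lemma exists_matrix_code:
  fixes F :: "'c \<Rightarrow> 'b \<Rightarrow> 'b"
  assumes "finite V" and "subspace V" and "card V = CARD('a) ^ CARD('n)"
    and linear: "\<And>s. s \<in> S \<Longrightarrow> Vector_Spaces.linear scale scale (F s)"
    and maps_to: "\<And>s. s \<in> S \<Longrightarrow> F s ` V \<subseteq> V"
    and low_rank: "\<And>s. s \<in> S \<Longrightarrow> card (F s ` V) \<le> CARD('a) ^ t"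
    and distance: "\<And>s u. s \<in> S \<Longrightarrow> u \<in> S \<Longrightarrow> s \<noteq> u \<Longrightarrow> card ((\<lambda>v. F s v - F u v) ` V) = CARD('a) ^ d"
    and "0 < d"
  shows "\<exists>C :: ('a^'n^'n) set. card C = card S \<and> (\<forall>c\<in>C. rank c \<le> t) \<and>
           (\<forall>c\<in>C. \<forall>c'\<in>C. c \<noteq> c' \<longrightarrow> rank (c - c') = d)"
proof -
  interpret endo: vector_space_pair scale scale ..
  obtain \<Phi> :: "'a^'n \<Rightarrow> 'b" where \<Phi>: "Vector_Spaces.linear (*s) scale \<Phi>" "\<Phi> ` UNIV = V" "inj \<Phi>"
    using exists_linear_iso[OF assms(1-3)] by blast
  define M where "M s = matrix_wrt \<Phi> (F s)" for s
  have q_gt_1: "1 < CARD('a)" using card_field_ge_2[where 'a='a] by simp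
  have rank_M: "rank (M s) \<le> t" if "s \<in> S" for s
    using power_rank_matrix_wrt[OF \<Phi> linear[OF that] maps_to[OF that]] low_rank[OF that]
    unfolding M_def by (simp add: power_le_imp_le_exp[OF q_gt_1])
  have rank_diff_M: "rank (M s - M u) = d" if "s \<in> S" "u \<in> S" "s \<noteq> u" for s u
  proof -
    have "M s - M u = matrix_wrt \<Phi> (\<lambda>v. F s v - F u v)"
      unfolding M_def using matrix_wrt_diff[OF \<Phi> maps_to[OF that(1)] maps_to[OF that(2)]] by simp
    moreover have "Vector_Spaces.linear scale scale (\<lambda>v. F s v - F u v)"
      using linear that by (intro endo.linear_compose_sub) auto
    moreover have "(\<lambda>v. F s v - F u v) ` V \<subseteq> V"
      using maps_to that by (auto intro: diff_mem_range[OF \<Phi>])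
    ultimately have "CARD('a) ^ rank (M s - M u) = CARD('a) ^ d"
      using power_rank_matrix_wrt[OF \<Phi>] distance[OF that] by simp
    thus ?thesis using q_gt_1 by (simp add: power_inject_exp)
  qed
  have "inj_on M S"
  proof (rule inj_onI, rule ccontr)
    fix s u assume "s \<in> S" "u \<in> S" "M s = M u" "s \<noteq> u"
    thus False using rank_diff_M[of s u] \<open>0 < d\<close> by (simp add: rank_zero)
  qed
  hence "card (M ` S) = card S" by (rule card_image)
  thus ?thesis using rank_M rank_diff_M by (intro exI[of _ "M ` S"]) blast
qed

end

section \<open>The code\<close>

definition code_map :: "('b::field \<Rightarrow> 'b) \<Rightarrow> 'b \<Rightarrow> 'b \<times> 'b \<Rightarrow> 'b \<times> 'b" where
  "code_map \<pi> s v = (fst v + \<pi> (s * snd v), s * (fst v + \<pi> (s * snd v)))"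

lemma inj_diff_twist:
  fixes s u :: "'b::field"
  assumes "s \<noteq> u"
  shows "inj (\<lambda>(a, b). (a - b, s * a - u * b))"
proof (rule injI, clarify)
  fix a b a' b' :: 'b
  assume "a - b = a' - b'" and "s * a - u * b = s * a' - u * b'"
  hence "a - a' = b - b'" by (simp add: algebra_simps)
  hence "(s - u) * (a - a') = s * (a - a') - u * (b - b')" by (simp add: left_diff_distrib)
  also have "\<dots> = (s * a - u * b) - (s * a' - u * b')" by (simp add: algebra_simps)
  finally have "(s - u) * (a - a') = 0" using \<open>s * a - u * b = s * a' - u * b'\<close> by simp
  hence "a = a'" using assms by simp
  thus "a = a' \<and> b = b'" using \<open>a - b = a' - b'\<close> by simp
qed

locale subfield_projection =
  fixes S U :: "'b::field set" and \<pi> :: "'b \<Rightarrow> 'b"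
  assumes diff_closed: "\<And>x y. x \<in> S \<Longrightarrow> y \<in> S \<Longrightarrow> x - y \<in> S"
    and mult_closed: "\<And>x y. x \<in> S \<Longrightarrow> y \<in> S \<Longrightarrow> x * y \<in> S"
    and inverse_closed: "\<And>x. x \<in> S \<Longrightarrow> inverse x \<in> S"
    and U_subset: "U \<subseteq> S"
    and U_add_closed: "\<And>x y. x \<in> U \<Longrightarrow> y \<in> U \<Longrightarrow> x + y \<in> U"
    and U_diff_closed: "\<And>x y. x \<in> U \<Longrightarrow> y \<in> U \<Longrightarrow> x - y \<in> U"
    and proj_mem: "\<And>x. x \<in> S \<Longrightarrow> \<pi> x \<in> U"
    and proj_id: "\<And>u. u \<in> U \<Longrightarrow> \<pi> u = u"
    and proj_diff: "\<And>x y. x \<in> S \<Longrightarrow> y \<in> S \<Longrightarrow> \<pi> (x - y) = \<pi> x - \<pi> y"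
begin

lemma code_map_image_subset:
  assumes "s \<in> S"
  shows "code_map \<pi> s ` (U \<times> S) \<subseteq> (\<lambda>w. (w, s * w)) ` U"
  using assms by (auto simp: code_map_def intro!: U_add_closed proj_mem mult_closed)

lemma code_map_diff_image:
  assumes "s \<in> S" and "u \<in> S" and "s \<noteq> u"
  shows "(\<lambda>v. code_map \<pi> s v - code_map \<pi> u v) ` (U \<times> S) = (\<lambda>(a, b). (a - b, s * a - u * b)) ` (U \<times> U)"
proof (intro equalityI subsetI)
  fix p assume "p \<in> (\<lambda>v. code_map \<pi> s v - code_map \<pi> u v) ` (U \<times> S)"
  then obtain x y where "x \<in> U" "y \<in> S" and p: "p = code_map \<pi> s (x, y) - code_map \<pi> u (x, y)"
    by auto
  have "x + \<pi> (s * y) \<in> U" "x + \<pi> (u * y) \<in> U"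
    using assms \<open>x \<in> U\<close> \<open>y \<in> S\<close> by (auto intro!: U_add_closed proj_mem mult_closed)
  thus "p \<in> (\<lambda>(a, b). (a - b, s * a - u * b)) ` (U \<times> U)"
    unfolding p by (intro image_eqI[of _ _ "(x + \<pi> (s * y), x + \<pi> (u * y))"]) (auto simp: code_map_def)
next
  fix p assume "p \<in> (\<lambda>(a, b). (a - b, s * a - u * b)) ` (U \<times> U)"
  then obtain a b where "a \<in> U" "b \<in> U" and p: "p = (a - b, s * a - u * b)"
    by auto
  \<comment> \<open>solve \<open>x + \<pi> (s y) = a\<close> and \<open>x + \<pi> (u y) = b\<close> for \<open>(x, y) \<in> U \<times> S\<close>\<close>
  define y where "y = inverse (s - u) * (a - b)"
  define x where "x = a - \<pi> (s * y)"
  have "a \<in> S" "b \<in> S" using \<open>a \<in> U\<close> \<open>b \<in> U\<close> U_subset by auto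
  hence "y \<in> S" unfolding y_def using assms by (intro mult_closed inverse_closed diff_closed)
  hence "x \<in> U" unfolding x_def using assms \<open>a \<in> U\<close> by (intro U_diff_closed proj_mem mult_closed)
  have "s * y - u * y = a - b" unfolding y_def using assms(3)
    by (simp add: left_diff_distrib[symmetric] mult.assoc[symmetric])
  hence "\<pi> (s * y) - \<pi> (u * y) = a - b"
    using proj_diff[of "s * y" "u * y"] proj_id U_diff_closed \<open>a \<in> U\<close> \<open>b \<in> U\<close> \<open>y \<in> S\<close> assms
    by (metis mult_closed)
  hence "x + \<pi> (u * y) = b" "x + \<pi> (s * y) = a" unfolding x_def by (simp_all add: algebra_simps)
  thus "p \<in> (\<lambda>v. code_map \<pi> s v - code_map \<pi> u v) ` (U \<times> S)"
    using \<open>x \<in> U\<close> \<open>y \<in> S\<close> unfolding p by (intro image_eqI[of _ _ "(x, y)"]) (auto simp: code_map_def)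
qed

lemma card_code_map_image:
  assumes "s \<in> S" and "finite U"
  shows "card (code_map \<pi> s ` (U \<times> S)) \<le> card U"
proof -
  have "card (code_map \<pi> s ` (U \<times> S)) \<le> card ((\<lambda>w. (w, s * w)) ` U)"
    using code_map_image_subset[OF assms(1)] assms(2) by (intro card_mono) auto
  also have "\<dots> \<le> card U" by (rule card_image_le[OF assms(2)])
  finally show ?thesis .
qed

lemma card_code_map_diff_image:
  assumes "s \<in> S" and "u \<in> S" and "s \<noteq> u"
  shows "card ((\<lambda>v. code_map \<pi> s v - code_map \<pi> u v) ` (U \<times> S)) = card U * card U"
  unfolding code_map_diff_image[OF assms]
  by (subst card_image[OF inj_on_subset[OF inj_diff_twist[OF assms(3)] subset_UNIV]])
     (simp add: card_cartesian_product)

end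

definition scale_ac :: "'a::field \<Rightarrow> 'a alg_closure \<Rightarrow> 'a alg_closure" where
  "scale_ac c z = to_ac c * z"

definition scale_ac_pair :: "'a::field \<Rightarrow> 'a alg_closure \<times> 'a alg_closure \<Rightarrow> 'a alg_closure \<times> 'a alg_closure" where
  "scale_ac_pair c v = (to_ac c * fst v, to_ac c * snd v)"

interpretation ac: finite_field_vector_space "scale_ac :: 'a::{finite,field} \<Rightarrow> _"
  by unfold_locales (simp_all add: scale_ac_def algebra_simps)

interpretation ac_pair: finite_field_vector_space "scale_ac_pair :: 'a::{finite,field} \<Rightarrow> _"
  by unfold_locales (simp_all add: scale_ac_pair_def algebra_simps)

lemma subspace_frobenius_fixed_field: "ac.subspace (frobenius_fixed_field k)"
proof (rule ac.subspaceI)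
  show "0 \<in> frobenius_fixed_field k"
    by (simp add: frobenius_fixed_field_def power_0_left)
qed (auto simp: scale_ac_def intro: frobenius_fixed_field_add frobenius_fixed_field_mult
      to_ac_in_frobenius_fixed_field)

lemma exists_rank_metric_code:
  assumes "0 < t" and "t \<le> k" and "t + k = CARD('n)"
  shows "\<exists>C :: ('a::{finite,field}^'n^'n) set. card C = CARD('a) ^ k \<and> (\<forall>c\<in>C. rank c \<le> t) \<and>
           (\<forall>c\<in>C. \<forall>c'\<in>C. c \<noteq> c' \<longrightarrow> rank (c - c') = 2 * t)"
proof -
  let ?q = "CARD('a)"
  define S :: "'a alg_closure set" where "S = frobenius_fixed_field k"
  have card_S: "card S = ?q ^ k"
    unfolding S_def using assms by (intro card_frobenius_fixed_field) simp
  hence "finite S" by (intro card_ge_0_finite) simp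
  have subspace_S: "ac.subspace S"
    unfolding S_def by (rule subspace_frobenius_fixed_field)
  have "ac.dim S = k" by (rule ac.dim_eq_if_card_eq[OF \<open>finite S\<close> subspace_S card_S])
  then obtain U \<pi> where U: "U \<subseteq> S" "ac.subspace U" "card U = ?q ^ t"
    and \<pi>: "Vector_Spaces.linear scale_ac scale_ac \<pi>" "\<pi> ` S \<subseteq> U" "\<And>u. u \<in> U \<Longrightarrow> \<pi> u = u"
    using ac.exists_projection_onto_subspace[OF \<open>finite S\<close> subspace_S]
      assms(2) by metis
  interpret endo: vector_space_pair "scale_ac :: 'a \<Rightarrow> _" scale_ac ..
  interpret subfield_projection S U \<pi>
    using U \<pi> unfolding S_def
    by unfold_locales (auto intro: frobenius_fixed_field_diff frobenius_fixed_field_mult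
        frobenius_fixed_field_inverse ac.subspace_add ac.subspace_diff endo.linear_diff[OF \<pi>(1)])
  define V where "V = U \<times> S"
  have "finite V" unfolding V_def using \<open>finite S\<close> finite_subset[OF U(1)] by blast
  have "ac_pair.subspace V"
    unfolding V_def ac_pair.subspace_def
    using U(2) subspace_S
    by (auto simp: ac.subspace_def scale_ac_def scale_ac_pair_def zero_prod_def)
  have "card V = ?q ^ CARD('n)"
    unfolding V_def using card_S U(3) assms(3) by (simp add: card_cartesian_product flip: power_add)
  have "\<exists>C :: ('a^'n^'n) set. card C = card S \<and> (\<forall>c\<in>C. rank c \<le> t) \<and>
      (\<forall>c\<in>C. \<forall>c'\<in>C. c \<noteq> c' \<longrightarrow> rank (c - c') = 2 * t)"
  proof (rule ac_pair.exists_matrix_code[where F = "code_map \<pi>"])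
    fix s assume "s \<in> S"
    have "\<pi> (s * (y + y')) = \<pi> (s * y) + \<pi> (s * y')" for y y'
      by (simp add: distrib_left endo.linear_add[OF \<pi>(1)])
    moreover have "\<pi> (s * (to_ac c * y)) = to_ac c * \<pi> (s * y)" for c y
      using endo.linear_scale[OF \<pi>(1), of c "s * y"] by (simp add: scale_ac_def mult_ac)
    ultimately show "Vector_Spaces.linear scale_ac_pair scale_ac_pair (code_map \<pi> s)"
      by (simp add: Vector_Spaces.linear_iff ac_pair.vector_space_axioms code_map_def
          scale_ac_pair_def algebra_simps)
    show "code_map \<pi> s ` V \<subseteq> V"
      using code_map_image_subset[OF \<open>s \<in> S\<close>] U(1) \<open>s \<in> S\<close> unfolding V_def by (auto intro: mult_closed)
    show "card (code_map \<pi> s ` V) \<le> ?q ^ t"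
      using card_code_map_image[OF \<open>s \<in> S\<close>] finite_subset[OF U(1) \<open>finite S\<close>] U(3)
      unfolding V_def by simp
  next
    fix s u assume "s \<in> S" "u \<in> S" "s \<noteq> u"
    thus "card ((\<lambda>v. code_map \<pi> s v - code_map \<pi> u v) ` V) = ?q ^ (2 * t)"
      using card_code_map_diff_image U(3) unfolding V_def by (simp add: mult_2 power_add)
  qed (use \<open>finite V\<close> \<open>ac_pair.subspace V\<close> \<open>card V = ?q ^ CARD('n)\<close> assms(1) in auto)
  thus ?thesis using card_S by simp
qed

lemma min_rank_distance_eqI:
  assumes "\<And>c c'. c \<in> C \<Longrightarrow> c' \<in> C \<Longrightarrow> c \<noteq> c' \<Longrightarrow> rank_dist c c' = d"
    and "c \<in> C" and "c' \<in> C" and "c \<noteq> c'"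
  shows "min_rank_distance C = d"
proof -
  have "{rank_dist c1 c2 | c1 c2. c1 \<in> C \<and> c2 \<in> C \<and> c1 \<noteq> c2} = {d}"
    using assms by blast
  thus ?thesis by (simp add: min_rank_distance_def)
qed

theorem corollary3:
  fixes d :: nat
  assumes "even d" and "0 < d" and "d \<le> CARD('n)"
  shows "\<exists>(C :: ('a::{finite,field}^'n^'n) set) r.
           2 \<le> card C \<and> min_rank_distance C = d \<and>
           CARD('a) ^ (CARD('n) - d div 2) \<le> card (C \<inter> rank_ball (d div 2) r)"
proof -
  let ?t = "d div 2" and ?k = "CARD('n) - d div 2"
  have "0 < ?t" "?t \<le> ?k" "?t + ?k = CARD('n)" "2 * ?t = d"
    using assms by auto
  then obtain C :: "('a^'n^'n) set" where card_C: "card C = CARD('a) ^ ?k"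
    and low_rank: "\<forall>c\<in>C. rank c \<le> ?t" and distance: "\<forall>c\<in>C. \<forall>c'\<in>C. c \<noteq> c' \<longrightarrow> rank (c - c') = d"
    using exists_rank_metric_code[where 'a='a and 'n='n] by metis
  have "CARD('a) ^ 1 \<le> card C"
    unfolding card_C using assms by (intro power_increasing) auto
  hence "2 \<le> card C" using card_field_ge_2[where 'a='a] by simp
  then obtain B where "B \<subseteq> C" "card B = 2" by (rule obtain_subset_with_card_n)
  then obtain c c' where "c \<in> C" "c' \<in> C" "c \<noteq> c'" by (auto simp: card_2_iff)
  hence "min_rank_distance C = d"
    using distance by (intro min_rank_distance_eqI) (auto simp: rank_dist_def)
  moreover have "C \<inter> rank_ball ?t 0 = C"
    using low_rank by (auto simp: rank_ball_def)
  ultimately show ?thesis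
    using \<open>2 \<le> card C\<close> card_C by (intro exI[of _ C] exI[of _ 0]) simp
qed

end
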